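(* Fix an evidentiary threshold $\tau$, an improvement ratio $r\in(0,1)$, and a feasibility ceiling $N_{\max}$. Fix any scoring rule, and let $p$ denote the harm rate the category exhibits under that rule. If $p<p_{\min}(\tau,N_{\max},r)$, where $$p_{\min}(\tau,N_{\max},r)\;\approx\;\frac{-\ln\tau}{N_{\max}(1-r)},$$ then no evaluation satisfying $n\le N_{\max}$, whose trials are approximately independent Bernoulli draws at rate $p$, can produce a zero-harm result constituting informative evidence of safety at threshold $\tau$, whatever its prompt diversity.
   Context: An evaluation of a model in a given harm category consists of $n$ trials (prompts), each of which is or is not judged harmful by a fixed scoring rule. The scoring rule defines the event counted and hence the harm rate $p$. Two hypotheses are compared: $H_1$ (elevated risk), under which the harm rate is $p$, and $H_0$ (acceptable risk), under which it is $rp$, where $r\in(0,1)$ is the improvement ratio. A zero-harm result is the outcome that none of the $n$ trials is harmful. Its likelihood ratio $P(\cdot\mid H_1)/P(\cdot\mid H_0)$ is taken to be $\Lambda_0(n,p)=[(1-p)/(1-rp)]^{n}$; posterior odds of $H_1$ against $H_0$ equal prior odds times $\Lambda_0$. A zero-harm result is informative evidence of safety at threshold $\tau$ if $\Lambda_0(n,p)\le\tau$. The feasibility ceiling $N_{\max}$ is the largest feasible number of approximately independent trials; "approximately independent" is used informally, without a quantitative definition. The boundary rate $p_{\min}(\tau,N_{\max},r)$ is the rate obtained by setting $\Lambda_0(N_{\max},p)=\tau$ and solving for $p$; the displayed formula is its first-order approximation. *)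

theory Defs
  imports "HOL-Probability.Probability"
begin

text \<open>
  An evaluation is a number of trials together with, for each trial, a random transcript
  (a prompt and the response of the model to it) on a common probability space.  The prompts
  are completely unconstrained: they may be deterministic or random, all equal or all different.
  A scoring rule is a predicate on transcripts; it holds on the transcripts judged harmful.
\<close>

record ('w, 'p, 'r) evaluation =
  law :: "'w measure"
  trials :: nat
  transcript :: "nat \<Rightarrow> 'w \<Rightarrow> 'p \<times> 'r"

type_synonym ('p, 'r) scoring_rule = "'p \<times> 'r \<Rightarrow> bool"

text \<open>A harm category is a probability measure on transcripts.\<close>

definition harm_rate :: "('p \<times> 'r) measure \<Rightarrow> ('p, 'r) scoring_rule \<Rightarrow> real" where
  "harm_rate C S = measure C {t \<in> space C. S t}"

definition bernoulli_draws ::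
    "('w, 'p, 'r) evaluation \<Rightarrow> ('p, 'r) scoring_rule \<Rightarrow> real \<Rightarrow> bool" where
  "bernoulli_draws E S q \<longleftrightarrow> prob_space (law E) \<and>
     (\<forall>i<trials E. (\<lambda>\<omega>. S (transcript E i \<omega>)) \<in> law E \<rightarrow>\<^sub>M count_space UNIV \<and>
        distr (law E) (count_space UNIV) (\<lambda>\<omega>. S (transcript E i \<omega>)) = measure_pmf (bernoulli_pmf q))"

definition independent_trials ::
    "('w, 'p, 'r) evaluation \<Rightarrow> ('p, 'r) scoring_rule \<Rightarrow> bool" where
  "independent_trials E S \<longleftrightarrow>
     prob_space.indep_vars (law E) (\<lambda>_. count_space UNIV) (\<lambda>i \<omega>. S (transcript E i \<omega>)) {..<trials E}"

definition zero_harm ::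
    "('w, 'p, 'r) evaluation \<Rightarrow> ('p, 'r) scoring_rule \<Rightarrow> 'w \<Rightarrow> bool" where
  "zero_harm E S \<omega> \<longleftrightarrow> (\<forall>i<trials E. \<not> S (transcript E i \<omega>))"

definition Lambda0 :: "real \<Rightarrow> nat \<Rightarrow> real \<Rightarrow> real" where
  "Lambda0 r n p = ((1 - p) / (1 - r * p)) ^ n"

text \<open>
  The outcome \<open>\<omega>\<close> is a zero-harm result, and this result is informative evidence of safety
  at threshold \<open>\<tau>\<close> when the harm rate is \<open>p\<close> under the elevated-risk hypothesis and
  \<open>r * p\<close> under the acceptable-risk hypothesis.
\<close>

definition informative_zero_harm ::
    "real \<Rightarrow> real \<Rightarrow> real \<Rightarrow> ('w, 'p, 'r) evaluation \<Rightarrow> ('p, 'r) scoring_rule \<Rightarrow> 'w \<Rightarrow> bool" where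
  "informative_zero_harm \<tau> r p E S \<omega> \<longleftrightarrow> zero_harm E S \<omega> \<and> Lambda0 r (trials E) p \<le> \<tau>"

text \<open>
  The exact boundary rate.  By the lemma \<open>ex1_boundary_rate\<close> below, the description is proper
  for all \<open>0 < \<tau> \<le> 1\<close>, \<open>0 < r < 1\<close> and \<open>N \<ge> 1\<close>.
\<close>

definition p_min :: "real \<Rightarrow> nat \<Rightarrow> real \<Rightarrow> real" where
  "p_min \<tau> N r = (THE q. 0 \<le> q \<and> q \<le> 1 \<and> Lambda0 r N q = \<tau>)"

lemma ex1_boundary_rate:
  fixes \<tau> r :: real
  assumes \<tau>: "0 < \<tau>" "\<tau> \<le> 1" and r: "0 < r" "r < 1" and N: "N \<ge> 1"
  shows "\<exists>!q. 0 \<le> q \<and> q \<le> 1 \<and> Lambda0 r N q = \<tau>"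
proof -
  define s where "s = root N \<tau>"
  have s: "0 < s" "s \<le> 1" "s ^ N = \<tau>"
    using \<tau> N by (auto simp: s_def)
  have rs: "r * s < 1"
    using mult_left_mono[of s 1 r] s r by linarith
  have iff: "Lambda0 r N q = \<tau> \<longleftrightarrow> q = (1 - s) / (1 - r * s)" if q: "0 \<le> q" "q \<le> 1" for q
  proof -
    have rq: "r * q < 1"
      using mult_left_mono[of q 1 r] q r by linarith
    have nn: "0 \<le> (1 - q) / (1 - r * q)"
      using q rq by auto
    have "Lambda0 r N q = \<tau> \<longleftrightarrow> ((1 - q) / (1 - r * q)) ^ N = s ^ N"
      by (simp add: Lambda0_def s)
    also have "\<dots> \<longleftrightarrow> (1 - q) / (1 - r * q) = s"
      using nn s N by (subst power_eq_iff_eq_base) auto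
    also have "\<dots> \<longleftrightarrow> 1 - q = s * (1 - r * q)"
      using rq by (simp add: divide_eq_eq)
    also have "\<dots> \<longleftrightarrow> q * (1 - r * s) = 1 - s"
      by (auto simp: algebra_simps)
    also have "\<dots> \<longleftrightarrow> q = (1 - s) / (1 - r * s)"
      using rs by (simp add: eq_divide_eq)
    finally show ?thesis .
  qed
  have "r * s \<le> s"
    using r s by (simp add: mult_le_cancel_right1)
  then have "0 \<le> (1 - s) / (1 - r * s)" "(1 - s) / (1 - r * s) \<le> 1"
    using s rs by (auto simp: divide_le_eq)
  with iff show ?thesis
    by metis
qed

text \<open>
  For exactly independent trials under both hypotheses, \<open>Lambda0\<close> is the likelihood ratio of the
  zero-harm event.  \<open>E1\<close> and \<open>E0\<close> describe the same evaluation under the elevated-risk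
  and the acceptable-risk hypothesis.
\<close>

lemma prob_zero_harm:
  assumes E: "bernoulli_draws E S q" "independent_trials E S" and q: "0 \<le> q" "q \<le> 1"
  shows "measure (law E) {\<omega> \<in> space (law E). zero_harm E S \<omega>} = (1 - q) ^ trials E"
proof -
  interpret prob_space "law E"
    using E by (simp add: bernoulli_draws_def)
  let ?X = "\<lambda>i \<omega>. S (transcript E i \<omega>)"
  have X: "?X i \<in> law E \<rightarrow>\<^sub>M count_space UNIV"
    "distr (law E) (count_space UNIV) (?X i) = measure_pmf (bernoulli_pmf q)"
    if "i < trials E" for i
    using E that by (auto simp: bernoulli_draws_def)
  have p: "prob (?X i -` {False} \<inter> space (law E)) = 1 - q" if "i < trials E" for i
  proof -
    have "prob (?X i -` {False} \<inter> space (law E)) = measure (measure_pmf (bernoulli_pmf q)) {False}"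
      using X[OF that] by (subst X(2)[OF that, symmetric], subst measure_distr) auto
    also have "\<dots> = 1 - q"
      using q by (simp add: measure_pmf_single)
    finally show ?thesis .
  qed
  show ?thesis
  proof (cases "trials E = 0")
    case True
    then show ?thesis
      by (simp add: zero_harm_def prob_space)
  next
    case False
    have "{\<omega> \<in> space (law E). zero_harm E S \<omega>} = (\<Inter>i\<in>{..<trials E}. ?X i -` {False} \<inter> space (law E))"
      using False by (auto simp: zero_harm_def)
    also have "prob \<dots> = (\<Prod>i<trials E. prob (?X i -` {False} \<inter> space (law E)))"
      using E(2) False unfolding independent_trials_def
      by (intro indep_varsD) auto
    also have "\<dots> = (1 - q) ^ trials E"
      using p by simp
    finally show ?thesis .
  qed
qed

lemma likelihood_ratio_zero_harm:
  assumes "bernoulli_draws E1 S p" "independent_trials E1 S"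
    and "bernoulli_draws E0 S (r * p)" "independent_trials E0 S"
    and "trials E1 = n" "trials E0 = n"
    and p: "0 \<le> p" "p \<le> 1" and r: "0 < r" "r < 1"
  shows "measure (law E1) {\<omega> \<in> space (law E1). zero_harm E1 S \<omega>} /
         measure (law E0) {\<omega> \<in> space (law E0). zero_harm E0 S \<omega>} = Lambda0 r n p"
proof -
  have "0 \<le> r * p" "r * p \<le> 1"
    using p r by (auto simp: mult_le_one)
  then show ?thesis
    using assms by (simp add: prob_zero_harm Lambda0_def power_divide)
qed

end

theory Submission
  imports Defs
begin

text \<open>
  With \<open>s = \<tau> powr (1/N) = exp (-x)\<close> and \<open>x = - ln \<tau> / N\<close>, the boundary rate is
  \<open>(1 - s) / (1 - r * s)\<close>, which differs from \<open>x / (1 - r)\<close> by \<open>O(x\<^sup>2)\<close>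
  uniformly in \<open>x \<ge> 0\<close>, because \<open>1 - x \<le> exp (-x) \<le> 1 - x + x\<^sup>2\<close>.
  The likelihood ratio is strictly decreasing in the rate and decreasing in the number of trials,
  so below the boundary rate it exceeds \<open>\<tau>\<close> for every admissible number of trials.
\<close>

lemma p_min_props:
  fixes \<tau> r :: real
  assumes "0 < \<tau>" "\<tau> \<le> 1" "0 < r" "r < 1" "N \<ge> 1"
  shows "0 \<le> p_min \<tau> N r" "p_min \<tau> N r \<le> 1" "Lambda0 r N (p_min \<tau> N r) = \<tau>"
  using theI'[OF ex1_boundary_rate[OF assms]] unfolding p_min_def by auto

text \<open>The \<open>N\<close>-th root of \<tau> is written as an exponential so that
  \<open>boundary_first_order_error\<close> applies with
  \<open>x = - (ln \<tau> / N)\<close>.\<close>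

lemma p_min_closed_form:
  fixes \<tau> r :: real
  assumes \<tau>: "0 < \<tau>" "\<tau> \<le> 1" and r: "0 < r" "r < 1" and N: "N \<ge> 1"
  defines "s \<equiv> exp (ln \<tau> / real N)"
  shows "p_min \<tau> N r = (1 - s) / (1 - r * s)"
  unfolding p_min_def
proof (rule the1_equality[OF ex1_boundary_rate[OF \<tau> r N]])
  let ?q = "(1 - s) / (1 - r * s)"
  have s: "0 < s" "s \<le> 1"
    using \<tau> N by (auto simp: s_def divide_le_0_iff)
  have sN: "s ^ N = \<tau>"
    using \<tau> N by (simp add: s_def flip: exp_of_nat_mult)
  have rs: "r * s < 1" "r * s \<le> s"
    using mult_left_mono[of s 1 r] mult_right_mono[of r 1 s] s r by linarith+
  \<comment> \<open>In the quotient of these two, \<open>(1 - r) / (1 - r * s)\<close> cancels and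
    leaves \<open>s\<close>.\<close>
  have "1 - ?q = s * (1 - r) / (1 - r * s)" "1 - r * ?q = (1 - r) / (1 - r * s)"
    using rs by (simp_all add: field_simps)
  then have "(1 - ?q) / (1 - r * ?q) = s"
    using rs r by simp
  then have "Lambda0 r N ?q = \<tau>"
    using sN by (simp add: Lambda0_def)
  moreover have "0 \<le> ?q" "?q \<le> 1"
    using s rs by (auto simp: divide_le_eq)
  ultimately show "0 \<le> ?q \<and> ?q \<le> 1 \<and> Lambda0 r N ?q = \<tau>"
    by blast
qed

text \<open>Inverting \<open>exp x \<ge> 1 + x\<close> leaves a rational inequality, which holds
  because \<open>(1 - x + x\<^sup>2) * (1 + x) = 1 + x ^ 3\<close>.\<close>

lemma exp_minus_le_quadratic:
  fixes x :: real
  assumes "0 \<le> x"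
  shows "exp (- x) \<le> 1 - x + x\<^sup>2"
proof -
  have "exp (- x) \<le> 1 / (1 + x)"
    using exp_ge_add_one_self[of x] assms by (simp add: exp_minus inverse_eq_divide frac_le)
  also have "\<dots> \<le> 1 - x + x\<^sup>2"
  proof -
    have "1 \<le> (1 - x + x\<^sup>2) * (1 + x)"
      using zero_le_power[OF assms, of 3]
      by (simp add: algebra_simps power2_eq_square power3_eq_cube)
    then show ?thesis
      using assms by (simp add: pos_divide_le_eq)
  qed
  finally show ?thesis .
qed

text \<open>The first-order value never falls below the exact one, so only their difference in that
  direction has to be estimated. The constant depends on \<open>r\<close> alone.\<close>

lemma boundary_first_order_error:
  fixes r x :: real
  assumes r: "0 < r" "r < 1" and x: "0 \<le> x"
  defines "s \<equiv> exp (- x)"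
  shows "\<bar>(1 - s) / (1 - r * s) - x / (1 - r)\<bar> \<le> 1 / (1 - r)\<^sup>2 * x\<^sup>2"
proof -
  have s: "0 < s" "s \<le> 1" "1 - s \<le> x" "s \<le> 1 - x + x\<^sup>2"
    using x exp_ge_add_one_self[of "- x"] exp_minus_le_quadratic[OF x] by (auto simp: s_def)
  have rs: "1 - r \<le> 1 - r * s"
    using mult_left_mono[of s 1 r] s r by linarith
  have "(1 - s) / (1 - r * s) \<le> x / (1 - r)"
    using s r rs x by (intro frac_le) auto
  moreover have "x / (1 - r) - (1 - s) / (1 - r * s) \<le> x\<^sup>2 / (1 - r)\<^sup>2"
  proof -
    \<comment> \<open>The numerator is grouped into two second-order quantities,
      \<open>s - 1 + x\<close> and \<open>x * (1 - s)\<close>. Each is at most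
      \<open>x\<^sup>2\<close>, and their weights \<open>1 - r\<close> and \<open>r\<close> add up
      to 1.\<close>
    have "x / (1 - r) - (1 - s) / (1 - r * s)
        = ((s - 1 + x) * (1 - r) + r * x * (1 - s)) / ((1 - r) * (1 - r * s))"
    proof (subst diff_frac_eq)
      show "1 - r \<noteq> 0" "1 - r * s \<noteq> 0"
        using r rs by linarith+
    qed (simp add: algebra_simps)
    also have "\<dots> \<le> x\<^sup>2 / (1 - r)\<^sup>2"
    proof (rule frac_le)
      have "(s - 1 + x) * (1 - r) \<le> x\<^sup>2 * (1 - r)"
        using s r by (intro mult_right_mono) auto
      moreover have "r * x * (1 - s) \<le> r * x * x"
        using s r x by (intro mult_left_mono) auto
      ultimately show "(s - 1 + x) * (1 - r) + r * x * (1 - s) \<le> x\<^sup>2"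
        by (simp add: algebra_simps power2_eq_square)
      show "(1 - r)\<^sup>2 \<le> (1 - r) * (1 - r * s)"
        using r rs by (simp add: power2_eq_square)
    qed (use r in auto)
    finally show ?thesis .
  qed
  moreover have "0 \<le> x\<^sup>2 / (1 - r)\<^sup>2"
    by simp
  ultimately show ?thesis
    by simp
qed

lemma Lambda0_strict_antimono:
  fixes r p q :: real
  assumes r: "0 < r" "r < 1" and pq: "0 \<le> p" "p < q" "q \<le> 1" and N: "N \<ge> 1"
  shows "Lambda0 r N q < Lambda0 r N p"
proof -
  have rq: "r * q < 1" "r * p < 1"
    using mult_left_mono[of q 1 r] mult_left_mono[of p 1 r] pq r by linarith+
  \<comment> \<open>This product is exactly the difference of the two sides after
    cross-multiplication.\<close>
  have "0 < (q - p) * (1 - r)"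
    using pq r by simp
  then have "(1 - q) * (1 - r * p) < (1 - p) * (1 - r * q)"
    by (simp add: algebra_simps)
  then have "(1 - q) / (1 - r * q) < (1 - p) / (1 - r * p)"
    using rq by (simp add: frac_less_eq divide_less_0_iff mult_less_0_iff mult_pos_pos)
  then show ?thesis
    unfolding Lambda0_def using pq rq N by (intro power_strict_mono) auto
qed

text \<open>From \<open>r * p \<le> p\<close> the base of the power lies between 0 and 1.\<close>

lemma Lambda0_antimono_trials:
  fixes r p :: real
  assumes r: "0 < r" "r < 1" and p: "0 \<le> p" "p \<le> 1" and "m \<le> n"
  shows "Lambda0 r n p \<le> Lambda0 r m p"
proof -
  have "r * p < 1" "r * p \<le> p"
    using mult_left_mono[of p 1 r] mult_right_mono[of r 1 p] p r by linarith+
  then show ?thesis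
    unfolding Lambda0_def using p \<open>m \<le> n\<close> by (intro power_decreasing) auto
qed

text \<open>Approximate independence has no quantitative definition, so it is an arbitrary predicate
  that holds of all exactly independent trials. The approximation sign becomes an error bound
  quadratic in \<open>ln t / N\<close>, with one \<open>K\<close> for all \<open>t\<close> and
  \<open>N\<close>.\<close>

theorem theorem2:
  fixes \<tau> r :: real and Nmax :: nat
    and approx_independent :: "('w, 'p, 'r) evaluation \<Rightarrow> ('p, 'r) scoring_rule \<Rightarrow> bool"
  assumes "0 < \<tau>" and "\<tau> \<le> 1" and "0 < r" and "r < 1" and "Nmax \<ge> 1"
    and "\<And>E S. independent_trials E S \<Longrightarrow> approx_independent E S"
  shows "(\<exists>K. \<forall>t N. 0 < t \<and> t \<le> 1 \<and> N \<ge> 1 \<longrightarrow>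
            \<bar>p_min t N r - (- ln t) / (real N * (1 - r))\<bar> \<le> K * (ln t / real N)\<^sup>2)
       \<and> (\<forall>(C :: ('p \<times> 'r) measure) (S :: ('p, 'r) scoring_rule) p.
            prob_space C \<and> Measurable.pred C S \<and> p = harm_rate C S \<and> p < p_min \<tau> Nmax r \<longrightarrow>
            \<not> (\<exists>(E :: ('w, 'p, 'r) evaluation) \<omega>.
                  trials E \<le> Nmax \<and> bernoulli_draws E S p \<and> approx_independent E S \<and>
                  \<omega> \<in> space (law E) \<and> informative_zero_harm \<tau> r p E S \<omega>))"
proof (intro conjI)
  show "\<exists>K. \<forall>t N. 0 < t \<and> t \<le> 1 \<and> N \<ge> 1 \<longrightarrow>
      \<bar>p_min t N r - (- ln t) / (real N * (1 - r))\<bar> \<le> K * (ln t / real N)\<^sup>2"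
  proof (intro exI allI impI, elim conjE)
    fix t :: real and N :: nat
    assume t: "0 < t" "t \<le> 1" and N: "N \<ge> 1"
    have "0 \<le> - (ln t / real N)"
      using t by (simp add: divide_le_0_iff)
    from boundary_first_order_error[OF assms(3,4) this]
    show "\<bar>p_min t N r - (- ln t) / (real N * (1 - r))\<bar> \<le> 1 / (1 - r)\<^sup>2 * (ln t / real N)\<^sup>2"
      using p_min_closed_form[OF t assms(3,4) N] by simp
  qed
next
  \<comment> \<open>Strictness comes from comparing rates at \<open>Nmax\<close>; passing to fewer
    trials can only raise the ratio. The case \<open>n = 0\<close>, where the ratio is 1, is
    included.\<close>
  have "\<tau> < Lambda0 r n p" if "0 \<le> p" "p < p_min \<tau> Nmax r" "n \<le> Nmax" for n p
  proof -
    note q = p_min_props[OF assms(1-5)]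
    have "\<tau> < Lambda0 r Nmax p"
      using Lambda0_strict_antimono[OF assms(3,4) that(1,2) q(2) assms(5)] q(3) by simp
    also have "\<dots> \<le> Lambda0 r n p"
      using that q assms by (intro Lambda0_antimono_trials) auto
    finally show ?thesis .
  qed
  \<comment> \<open>This supplies the lower bound on the rate that the monotonicity lemmas
    require.\<close>
  moreover have "0 \<le> harm_rate C S" for C :: "('p \<times> 'r) measure" and S
    by (simp add: harm_rate_def)
  ultimately show "\<forall>(C :: ('p \<times> 'r) measure) (S :: ('p, 'r) scoring_rule) p.
      prob_space C \<and> Measurable.pred C S \<and> p = harm_rate C S \<and> p < p_min \<tau> Nmax r \<longrightarrow>
      \<not> (\<exists>(E :: ('w, 'p, 'r) evaluation) \<omega>.
            trials E \<le> Nmax \<and> bernoulli_draws E S p \<and> approx_independent E S \<and>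
            \<omega> \<in> space (law E) \<and> informative_zero_harm \<tau> r p E S \<omega>)"
    unfolding informative_zero_harm_def by (meson not_le)
qed

end
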